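(* Let $P\in\mathbb{C}[z]$ be a polynomial in one variable with $P\neq 0$. Then the Euler operator $P(\theta):\mathscr{D}'(\mathbb{R})\to\mathscr{D}'(\mathbb{R})$ is surjective, i.e. for every $T\in\mathscr{D}'(\mathbb{R})$ there is $S\in\mathscr{D}'(\mathbb{R})$ with $P(\theta)S=T$.
   Context: $\mathscr{D}'(\mathbb{R})$ is the space of all Schwartz distributions on $\mathbb{R}$. Put $\theta=x\,d/dx$. For a polynomial $P(z)=\sum_k c_k z^k$ with complex coefficients, the Euler operator is $P(\theta)=\sum_k c_k\theta^k$, acting on distributions in the usual sense. *)

theory Defs
  imports "HOL-Analysis.Analysis" "HOL-Computational_Algebra.Polynomial"
begin

section \<open>Smooth functions on the real line\<close>

definition nderiv :: "nat \<Rightarrow> (real \<Rightarrow> complex) \<Rightarrow> real \<Rightarrow> complex" where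
  "nderiv k f = ((\<lambda>g x. vector_derivative g (at x)) ^^ k) f"

definition smooth :: "(real \<Rightarrow> complex) \<Rightarrow> bool" where
  "smooth f \<longleftrightarrow> (\<forall>k x. nderiv k f differentiable (at x))"

definition supp :: "(real \<Rightarrow> complex) \<Rightarrow> real set" where
  "supp f = closure {x. f x \<noteq> 0}"

lemma nderiv_0 [simp]: "nderiv 0 f = f"
  by (simp add: nderiv_def)

lemma nderiv_Suc: "nderiv (Suc k) f x = vector_derivative (nderiv k f) (at x)"
  by (simp add: nderiv_def)

lemma smooth_nderiv:
  assumes "smooth f"
  shows "(nderiv k f has_vector_derivative nderiv (Suc k) f x) (at x)"
  using assms by (simp add: smooth_def nderiv_Suc vector_derivative_works)

lemma nderiv_unique:
  assumes "F 0 = f" and "\<And>k x. (F k has_vector_derivative F (Suc k) x) (at x)"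
  shows "nderiv k f = F k"
proof (induction k)
  case 0
  then show ?case using assms(1) by simp
next
  case (Suc k)
  show ?case
    by (rule ext) (simp add: nderiv_Suc Suc.IH vector_derivative_at[OF assms(2)])
qed

lemma smoothI:
  assumes "F 0 = f" and "\<And>k x. (F k has_vector_derivative F (Suc k) x) (at x)"
  shows "smooth f"
  unfolding smooth_def nderiv_unique[of F, OF assms]
  using assms(2) differentiableI_vector by blast

lemma
  assumes "smooth f" "smooth g"
  shows smooth_add: "smooth (\<lambda>x. f x + g x)"
    and nderiv_add: "nderiv k (\<lambda>x. f x + g x) = (\<lambda>x. nderiv k f x + nderiv k g x)"
proof -
  let ?F = "\<lambda>k x. nderiv k f x + nderiv k g x"
  have *: "?F 0 = (\<lambda>x. f x + g x)"
    "\<And>k x. (?F k has_vector_derivative ?F (Suc k) x) (at x)"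
    by (auto intro!: has_vector_derivative_add smooth_nderiv assms)
  show "smooth (\<lambda>x. f x + g x)" by (rule smoothI[of ?F, OF *])
  show "nderiv k (\<lambda>x. f x + g x) = ?F k" by (rule nderiv_unique[of ?F, OF *])
qed

lemma
  assumes "smooth f"
  shows smooth_cmult: "smooth (\<lambda>x. c * f x)"
    and nderiv_cmult: "nderiv k (\<lambda>x. c * f x) = (\<lambda>x. c * nderiv k f x)"
proof -
  let ?F = "\<lambda>k x. c * nderiv k f x"
  have *: "?F 0 = (\<lambda>x. c * f x)"
    "\<And>k x. (?F k has_vector_derivative ?F (Suc k) x) (at x)"
    by (auto intro!: has_vector_derivative_mult_right smooth_nderiv assms)
  show "smooth (\<lambda>x. c * f x)" by (rule smoothI[of ?F, OF *])
  show "nderiv k (\<lambda>x. c * f x) = ?F k" by (rule nderiv_unique[of ?F, OF *])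
qed

lemma
  assumes "smooth f"
  shows smooth_deriv: "smooth (nderiv 1 f)"
    and nderiv_deriv: "nderiv k (nderiv 1 f) = nderiv (Suc k) f"
proof -
  let ?F = "\<lambda>k. nderiv (Suc k) f"
  have *: "?F 0 = nderiv 1 f"
    "\<And>k x. (?F k has_vector_derivative ?F (Suc k) x) (at x)"
    by (auto intro!: smooth_nderiv assms)
  show "smooth (nderiv 1 f)" by (rule smoothI[of ?F, OF *])
  show "nderiv k (nderiv 1 f) = ?F k" by (rule nderiv_unique[of ?F, OF *])
qed

lemma
  assumes "smooth f"
  shows smooth_xmult: "smooth (\<lambda>x. of_real x * f x)"
    and nderiv_xmult: "nderiv k (\<lambda>x. of_real x * f x)
          = (\<lambda>x. of_real x * nderiv k f x + of_nat k * nderiv (k - 1) f x)"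
proof -
  let ?F = "\<lambda>k x. of_real x * nderiv k f x + of_nat k * nderiv (k - 1) f x"
  have *: "?F 0 = (\<lambda>x. of_real x * f x)" by simp
  have **: "(?F k has_vector_derivative ?F (Suc k) x) (at x)" for k x
  proof -
    have 0: "((\<lambda>x. of_real x :: complex) has_vector_derivative 1) (at x)"
      using has_vector_derivative_of_real[OF DERIV_ident, where ?'a = complex] by simp
    have 1: "((\<lambda>x. of_real x * nderiv k f x) has_vector_derivative
          (of_real x * nderiv (Suc k) f x + 1 * nderiv k f x)) (at x)"
      by (rule has_vector_derivative_mult[OF 0 smooth_nderiv[OF assms]])
    have 2: "((\<lambda>x. of_nat k * nderiv (k - 1) f x) has_vector_derivative
          of_nat k * nderiv k f x) (at x)"
    proof (cases k)
      case (Suc j)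
      show ?thesis
        unfolding Suc diff_Suc_1
        by (rule has_vector_derivative_mult_right[OF smooth_nderiv[OF assms]])
    qed simp
    show ?thesis
      using has_vector_derivative_add[OF 1 2] by (simp add: algebra_simps)
  qed
  show "smooth (\<lambda>x. of_real x * f x)" by (rule smoothI[of ?F, OF * **])
  show "nderiv k (\<lambda>x. of_real x * f x) = ?F k" by (rule nderiv_unique[of ?F, OF * **])
qed

lemma supp_subset:
  assumes "\<And>x. x \<notin> supp f \<Longrightarrow> g x = 0"
  shows "supp g \<subseteq> supp f"
proof -
  have "{x. g x \<noteq> 0} \<subseteq> supp f" using assms by blast
  then show ?thesis unfolding supp_def by (simp add: closure_minimal)
qed

lemma zero_outside_supp: "x \<notin> supp f \<Longrightarrow> f x = 0"
  using closure_subset[of "{x. f x \<noteq> 0}"] unfolding supp_def by (metis (mono_tags, lifting) mem_Collect_eq subsetD)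

lemma nderiv_outside_supp:
  assumes "x \<notin> supp f"
  shows "nderiv k f x = 0"
  using assms
proof (induction k arbitrary: x)
  case 0
  then show ?case using zero_outside_supp[of x f] by simp
next
  case (Suc k)
  have op: "open (- supp f)" unfolding supp_def by (rule open_Compl[OF closed_closure])
  have "(nderiv k f has_vector_derivative 0) (at x)"
  proof (rule has_vector_derivative_transform_within_open[OF _ op])
    show "((\<lambda>_. 0) has_vector_derivative 0) (at x)" by simp
    show "x \<in> - supp f" using Suc.prems by simp
    show "0 = nderiv k f y" if "y \<in> - supp f" for y using Suc.IH[of y] that by simp
  qed
  then show ?case unfolding nderiv_Suc by (rule vector_derivative_at)
qed

lemma supp_add: "supp (\<lambda>x. f x + g x) \<subseteq> supp f \<union> supp g"
proof -
  have "{x. f x + g x \<noteq> 0} \<subseteq> {x. f x \<noteq> 0} \<union> {x. g x \<noteq> 0}" by auto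
  then show ?thesis unfolding supp_def closure_Un[symmetric] by (rule closure_mono)
qed


section \<open>Test functions\<close>

typedef test_fun = "{f :: real \<Rightarrow> complex. smooth f \<and> compact (supp f)}"
  morphisms fun_of Abs_test_fun
proof
  have "smooth (\<lambda>_. 0)" by (rule smoothI[of "\<lambda>_ _. 0"]) auto
  then show "(\<lambda>_. 0) \<in> {f :: real \<Rightarrow> complex. smooth f \<and> compact (supp f)}"
    by (simp add: supp_def)
qed

setup_lifting type_definition_test_fun

lemma compact_supp_subset:
  assumes "compact K" "supp f \<subseteq> K"
  shows "compact (supp f)"
  using compact_Int_closed[OF assms(1), of "supp f"] assms(2)
  by (simp add: supp_def Int_absorb1)

lemma compact_supp:
  assumes "compact (supp f)" and "\<And>x. x \<notin> supp f \<Longrightarrow> g x = 0"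
  shows "compact (supp g)"
  by (rule compact_supp_subset[OF assms(1) supp_subset]) (rule assms(2))

lift_definition test_add :: "test_fun \<Rightarrow> test_fun \<Rightarrow> test_fun"
  is "\<lambda>f g x. f x + g x"
  using compact_supp_subset[OF compact_Un supp_add] smooth_add by simp

lift_definition test_scale :: "complex \<Rightarrow> test_fun \<Rightarrow> test_fun"
  is "\<lambda>c f x. c * f x"
proof -
  fix c :: complex and f :: "real \<Rightarrow> complex"
  assume f: "smooth f \<and> compact (supp f)"
  have "compact (supp (\<lambda>x. c * f x))"
    by (rule compact_supp[of f]) (use f zero_outside_supp[of _ f] in auto)
  then show "smooth (\<lambda>x. c * f x) \<and> compact (supp (\<lambda>x. c * f x))"
    using f smooth_cmult by simp
qed

lift_definition test_deriv :: "test_fun \<Rightarrow> test_fun"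
  is "nderiv 1"
proof -
  fix f :: "real \<Rightarrow> complex"
  assume f: "smooth f \<and> compact (supp f)"
  have "compact (supp (nderiv 1 f))"
    by (rule compact_supp[of f]) (use f nderiv_outside_supp[of _ f 1] in auto)
  then show "smooth (nderiv 1 f) \<and> compact (supp (nderiv 1 f))"
    using f smooth_deriv by simp
qed

lift_definition test_xmult :: "test_fun \<Rightarrow> test_fun"
  is "\<lambda>f x. of_real x * f x"
proof -
  fix f :: "real \<Rightarrow> complex"
  assume f: "smooth f \<and> compact (supp f)"
  have "compact (supp (\<lambda>x. of_real x * f x))"
    by (rule compact_supp[of f]) (use f zero_outside_supp[of _ f] in auto)
  then show "smooth (\<lambda>x. of_real x * f x) \<and> compact (supp (\<lambda>x. of_real x * f x))"
    using f smooth_xmult by simp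
qed

text \<open>The \<open>C\<^sup>N\<close>-norm. The suprema are over bounded sets by \<open>bdd_nderiv\<close> below.\<close>

definition test_norm :: "nat \<Rightarrow> test_fun \<Rightarrow> real" where
  "test_norm N f = (\<Sum>k\<le>N. SUP x. norm (nderiv k (fun_of f) x))"

lemma fun_of_test: "smooth (fun_of f)" "compact (supp (fun_of f))"
  using fun_of[of f] by auto

lemma bdd_nderiv: "bdd_above (range (\<lambda>x. norm (nderiv k (fun_of f) x)))"
proof -
  let ?g = "nderiv k (fun_of f)"
  have "continuous_on (supp (fun_of f)) ?g"
    by (meson continuous_at_imp_continuous_on fun_of_test(1) has_vector_derivative_continuous
        smooth_nderiv)
  then have "bounded (?g ` supp (fun_of f))"
    using fun_of_test(2) compact_continuous_image compact_imp_bounded by blast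
  then obtain B where B: "\<And>x. x \<in> supp (fun_of f) \<Longrightarrow> norm (?g x) \<le> B"
    by (auto simp: bounded_iff)
  have "norm (?g x) \<le> max B 0" for x
    using B[of x] nderiv_outside_supp[of x "fun_of f" k]
    by (cases "x \<in> supp (fun_of f)") auto
  then show ?thesis by (auto simp: bdd_above_def)
qed

lemma norm_nderiv_le: "norm (nderiv k (fun_of f) x) \<le> (SUP x. norm (nderiv k (fun_of f) x))"
  by (rule cSUP_upper[OF UNIV_I bdd_nderiv])

lemma sup_nonneg: "0 \<le> (SUP x. norm (nderiv k (fun_of f) x))"
  using norm_nderiv_le[of k f 0] norm_ge_zero order_trans by blast

lemma test_norm_nonneg: "0 \<le> test_norm N f"
  unfolding test_norm_def by (intro sum_nonneg sup_nonneg)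

lemma test_norm_mono: "M \<le> N \<Longrightarrow> test_norm M f \<le> test_norm N f"
  unfolding test_norm_def by (intro sum_mono2) (auto simp: sup_nonneg)

lemma sup_le_test_norm: "k \<le> N \<Longrightarrow> (SUP x. norm (nderiv k (fun_of f) x)) \<le> test_norm N f"
  unfolding test_norm_def by (rule member_le_sum) (auto simp: sup_nonneg)

lemma test_norm_deriv: "test_norm N (test_deriv f) \<le> test_norm (Suc N) f"
proof -
  have "test_norm N (test_deriv f) = (\<Sum>k\<le>N. SUP x. norm (nderiv (Suc k) (fun_of f) x))"
    by (simp add: test_norm_def test_deriv.rep_eq nderiv_deriv fun_of_test del: One_nat_def)
  also have "\<dots> \<le> test_norm (Suc N) f"
    unfolding test_norm_def sum.atMost_Suc_shift using sup_nonneg[of 0 f] by linarith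
  finally show ?thesis .
qed

lemma test_norm_xmult:
  assumes "supp (fun_of f) \<subseteq> K" and K: "\<And>x. x \<in> K \<Longrightarrow> \<bar>x\<bar> \<le> R"
  shows "test_norm N (test_xmult f) \<le> real (Suc N) * (\<bar>R\<bar> + real N) * test_norm N f"
proof -
  have "(SUP x. norm (nderiv k (fun_of (test_xmult f)) x)) \<le> (\<bar>R\<bar> + real N) * test_norm N f"
    if k: "k \<le> N" for k
  proof (rule cSUP_least)
    fix x
    have a: "norm (of_real x * nderiv k (fun_of f) x) \<le> \<bar>R\<bar> * test_norm N f"
    proof (cases "x \<in> supp (fun_of f)")
      case True
      then have "\<bar>x\<bar> \<le> \<bar>R\<bar>" using assms by force
      moreover have "norm (nderiv k (fun_of f) x) \<le> test_norm N f"
        using norm_nderiv_le sup_le_test_norm[OF k] order_trans by blast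
      ultimately show ?thesis by (simp add: norm_mult mult_mono)
    qed (simp add: nderiv_outside_supp test_norm_nonneg)
    have b: "norm (of_nat k * nderiv (k - 1) (fun_of f) x) \<le> real N * test_norm N f"
    proof -
      have "norm (nderiv (k - 1) (fun_of f) x) \<le> test_norm N f"
        using norm_nderiv_le sup_le_test_norm[of "k - 1" N f] k order_trans
        by (meson diff_le_self)
      then show ?thesis using k by (simp add: norm_mult mult_mono)
    qed
    show "norm (nderiv k (fun_of (test_xmult f)) x) \<le> (\<bar>R\<bar> + real N) * test_norm N f"
      using norm_triangle_mono[OF a b]
      by (simp add: test_xmult.rep_eq nderiv_xmult fun_of_test algebra_simps)
  qed simp
  then have "test_norm N (test_xmult f) \<le> (\<Sum>k\<le>N. (\<bar>R\<bar> + real N) * test_norm N f)"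
    unfolding test_norm_def[of N "test_xmult f"] by (intro sum_mono) simp
  then show ?thesis by (simp add: mult.assoc)
qed


section \<open>Distributions\<close>

text \<open>
  For linear \<open>T\<close>, this seminorm estimate on each compact set is continuity with respect to the
  usual inductive-limit topology on the space of test functions.
\<close>

definition continuous_functional :: "(test_fun \<Rightarrow> complex) \<Rightarrow> bool" where
  "continuous_functional T \<longleftrightarrow> (\<forall>K. compact K \<longrightarrow>
     (\<exists>C N. \<forall>f. supp (fun_of f) \<subseteq> K \<longrightarrow> norm (T f) \<le> C * test_norm N f))"

definition linear_functional :: "(test_fun \<Rightarrow> complex) \<Rightarrow> bool" where
  "linear_functional T \<longleftrightarrow>
     (\<forall>f g. T (test_add f g) = T f + T g) \<and> (\<forall>c f. T (test_scale c f) = c * T f)"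

typedef distribution = "{T :: test_fun \<Rightarrow> complex. linear_functional T \<and> continuous_functional T}"
  morphisms pairing Abs_distribution
proof
  show "(\<lambda>_. 0) \<in> {T. linear_functional T \<and> continuous_functional T}"
    by (auto simp: linear_functional_def continuous_functional_def intro!: exI[of _ 0])
qed

setup_lifting type_definition_distribution

lemma continuous_functionalE:
  assumes "continuous_functional T" "compact K"
  obtains C N where "C \<ge> 0"
    "\<And>f. supp (fun_of f) \<subseteq> K \<Longrightarrow> norm (T f) \<le> C * test_norm N f"
proof -
  obtain C N where *: "\<And>f. supp (fun_of f) \<subseteq> K \<Longrightarrow> norm (T f) \<le> C * test_norm N f"
    using assms unfolding continuous_functional_def by blast
  have "norm (T f) \<le> \<bar>C\<bar> * test_norm N f" if "supp (fun_of f) \<subseteq> K" for f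
    using *[OF that] mult_right_mono[OF abs_ge_self[of C] test_norm_nonneg[of N f]] by linarith
  then show ?thesis using that[of "\<bar>C\<bar>" N] by simp
qed

lemma continuous_functional_add:
  assumes "continuous_functional S" "continuous_functional T"
  shows "continuous_functional (\<lambda>f. S f + T f)"
  unfolding continuous_functional_def
proof (intro allI impI)
  fix K :: "real set" assume K: "compact K"
  obtain C M where 1: "C \<ge> 0" "\<And>f. supp (fun_of f) \<subseteq> K \<Longrightarrow> norm (S f) \<le> C * test_norm M f"
    using continuous_functionalE[OF assms(1) K] by blast
  obtain D N where 2: "D \<ge> 0" "\<And>f. supp (fun_of f) \<subseteq> K \<Longrightarrow> norm (T f) \<le> D * test_norm N f"
    using continuous_functionalE[OF assms(2) K] by blast
  have "norm (S f + T f) \<le> (C + D) * test_norm (max M N) f" if f: "supp (fun_of f) \<subseteq> K" for f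
  proof -
    have "C * test_norm M f \<le> C * test_norm (max M N) f"
      "D * test_norm N f \<le> D * test_norm (max M N) f"
      using 1(1) 2(1) by (auto intro!: mult_left_mono test_norm_mono)
    then show ?thesis
      using norm_triangle_ineq[of "S f" "T f"] 1(2)[OF f] 2(2)[OF f]
      by (simp add: distrib_right)
  qed
  then show "\<exists>C N. \<forall>f. supp (fun_of f) \<subseteq> K \<longrightarrow> norm (S f + T f) \<le> C * test_norm N f"
    by blast
qed

lemma continuous_functional_cmult:
  assumes "continuous_functional T"
  shows "continuous_functional (\<lambda>f. c * T f)"
  unfolding continuous_functional_def
proof (intro allI impI)
  fix K :: "real set" assume K: "compact K"
  obtain C N where *: "\<And>f. supp (fun_of f) \<subseteq> K \<Longrightarrow> norm (T f) \<le> C * test_norm N f"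
    using continuous_functionalE[OF assms K] by blast
  have "norm (c * T f) \<le> (norm c * C) * test_norm N f" if "supp (fun_of f) \<subseteq> K" for f
    using mult_left_mono[OF *[OF that] norm_ge_zero[of c]] by (simp add: norm_mult mult.assoc)
  then show "\<exists>C N. \<forall>f. supp (fun_of f) \<subseteq> K \<longrightarrow> norm (c * T f) \<le> C * test_norm N f"
    by blast
qed

lemma continuous_functional_deriv:
  assumes "continuous_functional T"
  shows "continuous_functional (\<lambda>f. - T (test_deriv f))"
  unfolding continuous_functional_def
proof (intro allI impI)
  fix K :: "real set" assume K: "compact K"
  obtain C N where *: "C \<ge> 0" "\<And>f. supp (fun_of f) \<subseteq> K \<Longrightarrow> norm (T f) \<le> C * test_norm N f"
    using continuous_functionalE[OF assms K] by blast
  have "norm (- T (test_deriv f)) \<le> C * test_norm (Suc N) f" if "supp (fun_of f) \<subseteq> K" for f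
  proof -
    have "supp (fun_of (test_deriv f)) \<subseteq> K"
      using that supp_subset[of "fun_of f" "fun_of (test_deriv f)"]
        nderiv_outside_supp[of _ "fun_of f" 1]
      by (auto simp: test_deriv.rep_eq)
    then have "norm (T (test_deriv f)) \<le> C * test_norm N (test_deriv f)" by (rule *)
    also have "\<dots> \<le> C * test_norm (Suc N) f" by (intro mult_left_mono test_norm_deriv *)
    finally show ?thesis by simp
  qed
  then show "\<exists>C N. \<forall>f. supp (fun_of f) \<subseteq> K \<longrightarrow> norm (- T (test_deriv f)) \<le> C * test_norm N f"
    by blast
qed

lemma continuous_functional_xmult:
  assumes "continuous_functional T"
  shows "continuous_functional (\<lambda>f. T (test_xmult f))"
  unfolding continuous_functional_def
proof (intro allI impI)
  fix K :: "real set" assume K: "compact K"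
  obtain C N where *: "C \<ge> 0" "\<And>f. supp (fun_of f) \<subseteq> K \<Longrightarrow> norm (T f) \<le> C * test_norm N f"
    using continuous_functionalE[OF assms K] by blast
  obtain R where R: "\<And>x. x \<in> K \<Longrightarrow> \<bar>x\<bar> \<le> R"
    using compact_imp_bounded[OF K] by (auto simp: bounded_iff)
  let ?C = "C * (real (Suc N) * (\<bar>R\<bar> + real N))"
  have "norm (T (test_xmult f)) \<le> ?C * test_norm N f" if f: "supp (fun_of f) \<subseteq> K" for f
  proof -
    have "supp (fun_of (test_xmult f)) \<subseteq> K"
      using that supp_subset[of "fun_of f" "fun_of (test_xmult f)"] zero_outside_supp[of _ "fun_of f"]
      by (auto simp: test_xmult.rep_eq)
    then have "norm (T (test_xmult f)) \<le> C * test_norm N (test_xmult f)" by (rule *)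
    also have "\<dots> \<le> C * (real (Suc N) * (\<bar>R\<bar> + real N) * test_norm N f)"
      by (intro mult_left_mono test_norm_xmult[OF f R] *)
    finally show ?thesis by (simp only: mult.assoc)
  qed
  then show "\<exists>C N. \<forall>f. supp (fun_of f) \<subseteq> K \<longrightarrow> norm (T (test_xmult f)) \<le> C * test_norm N f"
    by blast
qed

instantiation distribution :: ab_group_add
begin

lift_definition zero_distribution :: distribution is "\<lambda>_. 0"
  by (auto simp: linear_functional_def continuous_functional_def intro!: exI[of _ 0])

lift_definition plus_distribution :: "distribution \<Rightarrow> distribution \<Rightarrow> distribution"
  is "\<lambda>S T f. S f + T f"
  by (auto simp: linear_functional_def algebra_simps intro: continuous_functional_add)

lift_definition uminus_distribution :: "distribution \<Rightarrow> distribution"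
  is "\<lambda>T f. - T f"
  using continuous_functional_cmult[of _ "-1"] by (auto simp: linear_functional_def)

definition minus_distribution :: "distribution \<Rightarrow> distribution \<Rightarrow> distribution" where
  "S - T = S + - (T :: distribution)"

instance
  by standard (transfer; auto simp: minus_distribution_def)+

end

lift_definition dist_scale :: "complex \<Rightarrow> distribution \<Rightarrow> distribution"
  is "\<lambda>c T f. c * T f"
  by (auto simp: linear_functional_def algebra_simps intro: continuous_functional_cmult)

lemma test_deriv_add: "test_deriv (test_add f g) = test_add (test_deriv f) (test_deriv g)"
  by transfer (simp add: nderiv_add)

lemma test_deriv_scale: "test_deriv (test_scale c f) = test_scale c (test_deriv f)"
  by transfer (simp add: nderiv_cmult)

lemma test_xmult_add: "test_xmult (test_add f g) = test_add (test_xmult f) (test_xmult g)"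
  by transfer (simp add: algebra_simps)

lemma test_xmult_scale: "test_xmult (test_scale c f) = test_scale c (test_xmult f)"
  by transfer (simp add: algebra_simps)

lift_definition dist_deriv :: "distribution \<Rightarrow> distribution"
  is "\<lambda>T f. - T (test_deriv f)"
  by (auto simp: linear_functional_def test_deriv_add test_deriv_scale
      intro: continuous_functional_deriv)

text \<open>The pairing is bilinear (no complex conjugation), so multiplication by \<open>x\<close> is its own transpose.\<close>

lift_definition dist_xmult :: "distribution \<Rightarrow> distribution"
  is "\<lambda>T f. T (test_xmult f)"
  by (auto simp: linear_functional_def test_xmult_add test_xmult_scale
      intro: continuous_functional_xmult)


section \<open>Euler operators\<close>

definition theta :: "distribution \<Rightarrow> distribution" where
  "theta T = dist_xmult (dist_deriv T)"

definition euler_op :: "complex poly \<Rightarrow> distribution \<Rightarrow> distribution" where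
  "euler_op P T = (\<Sum>k\<le>degree P. dist_scale (coeff P k) ((theta ^^ k) T))"

end

theory Submission
  imports Defs "HOL-Computational_Algebra.Fundamental_Theorem_Algebra"
begin

text \<open>
  Over the complex numbers \<open>P\<close> splits into linear factors, \<open>P(\<theta>)\<close> is the corresponding
  composition, and a composition of surjections is surjective. So the point is that \<open>\<theta> - a\<close> is
  surjective on distributions for every complex \<open>a\<close>.
  
  Let \<open>A\<close> be the transpose of \<open>\<theta> - a\<close>, acting on test functions. If \<open>B\<close> is a continuous linear
  operator on test functions with \<open>B (A f) = f\<close> for all \<open>f\<close>, then \<open>S = T \<circ> B\<close> solves
  \<open>(\<theta> - a) S = T\<close> (\<open>surj_if_transpose_left_inverse\<close>). So it suffices to solve \<open>A f = g\<close> for \<open>f\<close> by a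
  formula that yields a test function for every test function \<open>g\<close>, whether or not \<open>g\<close> lies in
  the range of \<open>A\<close>.
  
  Integrating the ordinary differential equation along rays gives two such formulas, one integrating
  from infinity and one from the origin. Each produces a function that is bad at the end opposite to
  its starting point (not smooth at \<open>0\<close>, respectively not compactly supported). They agree on the
  range of \<open>A\<close>, hence any combination of the two with weights \<open>e\<close> and \<open>1 - e\<close> is still a
  left inverse, and a smooth cutoff \<open>e\<close> selects the good formula at each end. This settles
  \<open>Re a > 0\<close> (\<open>surj_theta_minus_Re_pos\<close>). The same gluing, between the two ends of the line,
  shows that \<open>d/dx\<close> is surjective (\<open>surj_dist_deriv\<close>), and the commutation of \<open>d/dx\<close> with \<open>\<theta>\<close>
  then moves \<open>a\<close> to an arbitrary position (\<open>surj_theta_minus\<close>).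
  
  The four pieces that are glued are all integrals of \<open>f\<close> over an affine family of points, times
  a multiplier; \<open>cutoff_integral_operator\<close> proves their continuity in one go.
\<close>

section \<open>Calculus of smooth functions\<close>

lemma smooth_continuous_on: "smooth f \<Longrightarrow> continuous_on S (nderiv k f)"
  by (meson continuous_at_imp_continuous_on has_vector_derivative_continuous smooth_nderiv)

lemma smooth_affine:
  assumes "smooth f"
  shows "smooth (\<lambda>x. f (c * x + d))"
proof -
  let ?F = "\<lambda>k x. of_real c ^ k * nderiv k f (c * x + d)"
  have *: "?F 0 = (\<lambda>x. f (c * x + d))" by simp
  have **: "(?F k has_vector_derivative ?F (Suc k) x) (at x)" for k x
  proof -
    have "((\<lambda>x. c * x + d) has_vector_derivative c) (at x)"
      by (auto intro!: derivative_eq_intros)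
    from vector_diff_chain_at[OF this smooth_nderiv[OF assms, of k]]
    have "((\<lambda>x. nderiv k f (c * x + d)) has_vector_derivative c *\<^sub>R nderiv (Suc k) f (c * x + d)) (at x)"
      by (simp add: o_def)
    from has_vector_derivative_mult_right[OF this, of "of_real c ^ k"]
    show ?thesis by (simp add: scaleR_conv_of_real algebra_simps)
  qed
  show "smooth (\<lambda>x. f (c * x + d))" by (rule smoothI[of ?F, OF * **])
qed

lemma
  assumes "smooth f" "smooth g"
  shows smooth_mult: "smooth (\<lambda>x. f x * g x)"
    and nderiv_mult: "nderiv k (\<lambda>x. f x * g x) =
      (\<lambda>x. \<Sum>i=0..k. of_nat (k choose i) * nderiv i f x * nderiv (k - i) g x)"
proof -
  have choose: "Suc n choose i = (n choose i) + (if i = 0 then 0 else n choose (i - 1))" for n i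
    by (cases i) simp_all
  let ?F = "\<lambda>k x. \<Sum>i=0..k. of_nat (k choose i) * nderiv i f x * nderiv (k - i) g x"
  have *: "?F 0 = (\<lambda>x. f x * g x)" by simp
  have **: "(?F k has_vector_derivative ?F (Suc k) x) (at x)" for k x
  proof -
    have "(?F k has_vector_derivative
        (\<Sum>i=0..k. of_nat (k choose i) *
          (nderiv (Suc i) f x * nderiv (k - i) g x + nderiv (Suc (k - i)) g x * nderiv i f x))) (at x)"
    proof (rule has_vector_derivative_sum)
      fix i assume "i \<in> {0..k}"
      have "((\<lambda>x. nderiv i f x * nderiv (k - i) g x) has_vector_derivative
          (nderiv i f x * nderiv (Suc (k - i)) g x + nderiv (Suc i) f x * nderiv (k - i) g x)) (at x)"
        by (rule has_vector_derivative_mult[OF smooth_nderiv[OF assms(1)] smooth_nderiv[OF assms(2)]])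
      from has_vector_derivative_mult_right[OF this, of "of_nat (k choose i)"]
      show "((\<lambda>x. of_nat (k choose i) * nderiv i f x * nderiv (k - i) g x) has_vector_derivative
          of_nat (k choose i) * (nderiv (Suc i) f x * nderiv (k - i) g x +
            nderiv (Suc (k - i)) g x * nderiv i f x)) (at x)"
        by (simp add: algebra_simps)
    qed
    also have "(\<Sum>i=0..k. of_nat (k choose i) *
          (nderiv (Suc i) f x * nderiv (k - i) g x + nderiv (Suc (k - i)) g x * nderiv i f x)) =
        g x * nderiv (Suc k) f x
          + (\<Sum>i=0..k. nderiv i f x * (of_nat (Suc k choose i) * nderiv (Suc k - i) g x))"
      apply (simp add: choose algebra_simps sum.distrib)
      apply (subst (4) sum_Suc_reindex)
      apply (auto simp: algebra_simps Suc_diff_le intro: sum.cong)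
      done
    also have "\<dots> = ?F (Suc k) x"
      by (simp add: algebra_simps)
    finally show ?thesis .
  qed
  show "smooth (\<lambda>x. f x * g x)" by (rule smoothI[of ?F, OF * **])
  show "nderiv k (\<lambda>x. f x * g x) = ?F k" by (rule nderiv_unique[of ?F, OF * **])
qed

lemma smooth_const: "smooth (\<lambda>_. c)"
  by (rule smoothI[of "\<lambda>k _. if k = 0 then c else 0"]) auto

lemma smooth_minus: "smooth f \<Longrightarrow> smooth (\<lambda>x. - f x)"
  using smooth_cmult[of f "-1"] by simp

lemma smooth_diff: "smooth f \<Longrightarrow> smooth g \<Longrightarrow> smooth (\<lambda>x. f x - g x)"
  using smooth_add[of f "\<lambda>x. - g x"] smooth_minus[of g] by simp

lemma smooth_antiderivative:
  assumes "smooth g" and "\<And>x. (f has_vector_derivative g x) (at x)"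
  shows "smooth f"
proof (rule smoothI[of "\<lambda>k. case k of 0 \<Rightarrow> f | Suc j \<Rightarrow> nderiv j g"])
  show "((case k of 0 \<Rightarrow> f | Suc j \<Rightarrow> nderiv j g) has_vector_derivative
      (case Suc k of 0 \<Rightarrow> f | Suc j \<Rightarrow> nderiv j g) x) (at x)" for k x
    using assms by (cases k) (simp_all add: smooth_nderiv)
qed simp

section \<open>A smooth step function\<close>

text \<open>
  The function \<open>p(1/x) exp(-1/x)\<close> on the right half line, extended by zero. Keeping the polynomial
  \<open>p\<close> as a parameter makes the family closed under differentiation, which is how smoothness at
  the origin is obtained; the flat function that is wanted in the end is the case \<open>p = 1\<close>.
\<close>

definition flat :: "real poly \<Rightarrow> real \<Rightarrow> real" where
  "flat p x = (if x \<le> 0 then 0 else poly p (inverse x) * exp (- inverse x))"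

lemma poly_times_exp_tendsto_0: "((\<lambda>u. poly p u * exp (- u)) \<longlongrightarrow> (0::real)) at_top"
proof -
  have "((\<lambda>u. \<Sum>i\<le>degree p. coeff p i * (u ^ i / exp u)) \<longlongrightarrow> (\<Sum>i\<le>degree p. coeff p i * 0)) at_top"
    by (intro tendsto_intros tendsto_power_div_exp_0)
  then show ?thesis
    by (simp add: poly_altdef exp_minus sum_distrib_right divide_inverse mult.assoc)
qed

lemma flat_has_derivative:
  "(flat p has_real_derivative flat (monom 1 2 * (p - pderiv p)) x) (at x)"
proof -
  consider "x < 0" | "x = 0" | "x > 0" by linarith
  then show ?thesis
  proof cases
    case 1
    have "((\<lambda>_. 0) has_real_derivative 0) (at x)" by simp
    then have "(flat p has_real_derivative 0) (at x)"
      by (rule has_field_derivative_transform_within_open[where S="{..<0}"])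
        (use 1 in \<open>auto simp: flat_def\<close>)
    then show ?thesis using 1 by (simp add: flat_def)
  next
    case 3
    have "((\<lambda>x. poly p (inverse x) * exp (- inverse x)) has_real_derivative
        flat (monom 1 2 * (p - pderiv p)) x) (at x)"
      using 3 by (auto intro!: derivative_eq_intros DERIV_chain2[OF poly_DERIV]
          simp: flat_def poly_monom power2_eq_square algebra_simps)
    then show ?thesis
      by (rule has_field_derivative_transform_within_open[where S="{0<..}"])
        (use 3 in \<open>auto simp: flat_def\<close>)
  next
    case 2
    have "((\<lambda>y. flat p y / y) \<longlongrightarrow> 0) (at 0)"
    proof (rule filterlim_split_at)
      show "((\<lambda>y. flat p y / y) \<longlongrightarrow> 0) (at_left 0)"
        by (rule tendsto_eventually) (simp add: eventually_at_filter flat_def)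
      (* The extra factor 1/y of the difference quotient is absorbed into the polynomial. *)
      have "((\<lambda>y. poly (pCons 0 p) (inverse y) * exp (- inverse y)) \<longlongrightarrow> 0) (at_right (0::real))"
        by (rule filterlim_compose[OF poly_times_exp_tendsto_0 filterlim_inverse_at_top_right])
      then show "((\<lambda>y. flat p y / y) \<longlongrightarrow> 0) (at_right 0)"
        by (rule Lim_transform_eventually)
          (simp add: eventually_at_filter flat_def divide_inverse mult_ac)
    qed
    then show ?thesis
      using 2 by (simp add: has_field_derivative_iff flat_def)
  qed
qed

text \<open>
  Differentiation acts on the polynomials alone, by \<open>p \<mapsto> X\<^sup>2 (p - p')\<close>, so iterating
  this map lists all derivatives.
\<close>

lemma smooth_flat: "smooth (\<lambda>x. of_real (flat p x))"
proof -
  define q where "q = rec_nat p (\<lambda>_ r. monom 1 2 * (r - pderiv r))"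
  show ?thesis
  proof (rule smoothI[of "\<lambda>k x. of_real (flat (q k) x)"])
    show "((\<lambda>x. of_real (flat (q k) x) :: complex) has_vector_derivative of_real (flat (q (Suc k)) x)) (at x)" for k x
      unfolding q_def by (simp add: has_vector_derivative_of_real flat_has_derivative)
  qed (simp add: q_def)
qed

text \<open>
  The step is the normalised primitive of the bump \<open>\<rho>(x) = exp(-1/x) exp(-1/(1-x))\<close>, which lives
  on the unit interval; a primitive of a smooth function is smooth.
\<close>

lemma smooth_step_exists:
  obtains h :: "real \<Rightarrow> complex"
  where "smooth h" and "\<And>x. x \<le> 0 \<Longrightarrow> h x = 0" and "\<And>x. x \<ge> 1 \<Longrightarrow> h x = 1"
proof -
  define \<rho> where "\<rho> x = flat 1 x * flat 1 (1 - x)" for x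
  define h where "h x = integral {-1..x} \<rho>" for x
  have "smooth (\<lambda>x. of_real (flat 1 x) * of_real (flat 1 ((-1) * x + 1)))"
    by (intro smooth_mult smooth_affine[of "\<lambda>x. of_real (flat 1 x)"] smooth_flat)
  then have smooth: "smooth (\<lambda>x. of_real (\<rho> x))" by (simp add: \<rho>_def)
  have flat_cont: "continuous_on S (flat p)" for p S
    by (meson DERIV_isCont continuous_at_imp_continuous_on flat_has_derivative)
  have cont: "continuous_on S \<rho>" for S
    unfolding \<rho>_def by (intro continuous_intros continuous_on_compose2[OF flat_cont]) auto
  have zero: "\<rho> x = 0" if "x \<le> 0 \<or> x \<ge> 1" for x
    using that by (auto simp: \<rho>_def flat_def)
  have pos: "\<rho> x > 0" if "0 < x" "x < 1" for x
    using that by (simp add: \<rho>_def flat_def)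
  have nonneg: "\<rho> x \<ge> 0" for x
    by (metis zero pos less_eq_real_def not_less)
  have h0: "h x = 0" if "x \<le> 0" for x
  proof -
    have "h x = integral {-1..x} (\<lambda>_. 0)"
      unfolding h_def by (rule integral_cong) (use that zero in auto)
    then show ?thesis by simp
  qed
  have h1: "h x = h 1" if "x \<ge> 1" for x
  proof -
    have "h x = integral {-1..1} \<rho> + integral {1..x} \<rho>"
      unfolding h_def
      by (rule Henstock_Kurzweil_Integration.integral_combine[symmetric]) (use that cont in \<open>auto intro: integrable_continuous_real\<close>)
    also have "integral {1..x} \<rho> = integral {1..x} (\<lambda>_. 0)"
      by (rule integral_cong) (use zero in auto)
    finally show ?thesis by (simp add: h_def)
  qed
  (* The primitive starts at -1, so that every x >= 0 is interior to a range of integration. *)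
  have "(h has_vector_derivative \<rho> x) (at x)" for x
  proof (cases "x < 0")
    case True
    have "((\<lambda>_. 0) has_vector_derivative 0) (at x)" by simp
    then have "(h has_vector_derivative 0) (at x)"
      by (rule has_vector_derivative_transform_within_open[where S="{..<0}"]) (use True h0 in auto)
    then show ?thesis using True zero by simp
  next
    case False
    have "(h has_vector_derivative \<rho> x) (at x within {-1..x+1})"
      unfolding h_def by (rule integral_has_vector_derivative[OF cont]) (use False in auto)
    moreover have "at x within {-1..x+1} = at x"
      by (rule at_within_interior) (use False in auto)
    ultimately show ?thesis by simp
  qed
  then have "((\<lambda>x. of_real (h x) :: complex) has_vector_derivative of_real (\<rho> x)) (at x)" for x
    by (simp add: has_vector_derivative_of_real has_real_derivative_iff_has_vector_derivative)
  from smooth_antiderivative[OF smooth this] have hs: "smooth (\<lambda>x. of_real (h x))" .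
  have "h 1 \<noteq> 0"
    using integral_eq_0_iff[OF cont, of "-1" 1] nonneg pos[of "1/2"]
    by (force simp: h_def)
  show thesis
  proof
    show "smooth (\<lambda>x. inverse (of_real (h 1)) * of_real (h x))" by (rule smooth_cmult[OF hs])
    show "inverse (of_real (h 1)) * of_real (h x) = (1::complex)" if "x \<ge> 1" for x
      using h1[OF that] \<open>h 1 \<noteq> 0\<close> by simp
  qed (simp add: h0)
qed

section \<open>Continuous operators on test functions and their transposes\<close>

text \<open>
  Linear maps that are continuous for the inductive-limit topology on the space of test functions:
  supports in a compact set are sent to supports in a compact set, with seminorm estimates. The
  set \<open>K'\<close> comes before \<open>N\<close> because it must serve for all seminorms at once.
\<close>

definition continuous_operator :: "(test_fun \<Rightarrow> test_fun) \<Rightarrow> bool" where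
  "continuous_operator B \<longleftrightarrow>
     (\<forall>f g. B (test_add f g) = test_add (B f) (B g)) \<and>
     (\<forall>c f. B (test_scale c f) = test_scale c (B f)) \<and>
     (\<forall>K. compact K \<longrightarrow> (\<exists>K'. compact K' \<and> (\<forall>N. \<exists>C M. \<forall>f. supp (fun_of f) \<subseteq> K \<longrightarrow>
        supp (fun_of (B f)) \<subseteq> K' \<and> test_norm N (B f) \<le> C * test_norm M f)))"

lemma continuous_operatorE:
  assumes "continuous_operator B" "compact K"
  obtains K' where "compact K'"
    "\<forall>N. \<exists>C M. \<forall>f. supp (fun_of f) \<subseteq> K \<longrightarrow>
        supp (fun_of (B f)) \<subseteq> K' \<and> test_norm N (B f) \<le> C * test_norm M f"
proof -
  have "\<exists>K'. compact K' \<and> (\<forall>N. \<exists>C M. \<forall>f. supp (fun_of f) \<subseteq> K \<longrightarrow>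
      supp (fun_of (B f)) \<subseteq> K' \<and> test_norm N (B f) \<le> C * test_norm M f)"
    using assms unfolding continuous_operator_def by simp
  then show thesis by (elim exE conjE) (rule that)
qed

lemma continuous_operator_add:
  assumes "continuous_operator A" "continuous_operator B"
  shows "continuous_operator (\<lambda>f. test_add (A f) (B f))"
  unfolding continuous_operator_def
proof (intro conjI allI impI)
  show "test_add (A (test_add f g)) (B (test_add f g)) =
      test_add (test_add (A f) (B f)) (test_add (A g) (B g))" for f g
    using assms unfolding continuous_operator_def
    by (simp add: test_add.rep_eq algebra_simps flip: fun_of_inject)
  show "test_add (A (test_scale c f)) (B (test_scale c f)) = test_scale c (test_add (A f) (B f))" for c f
    using assms unfolding continuous_operator_def
    by (simp add: test_add.rep_eq test_scale.rep_eq algebra_simps flip: fun_of_inject)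
  fix K :: "real set" assume "compact K"
  obtain K1 where K1: "compact K1" "\<forall>N. \<exists>C M. \<forall>f. supp (fun_of f) \<subseteq> K \<longrightarrow>
      supp (fun_of (A f)) \<subseteq> K1 \<and> test_norm N (A f) \<le> C * test_norm M f"
    by (rule continuous_operatorE[OF assms(1) \<open>compact K\<close>], rule that)
  obtain K2 where K2: "compact K2" "\<forall>N. \<exists>C M. \<forall>f. supp (fun_of f) \<subseteq> K \<longrightarrow>
      supp (fun_of (B f)) \<subseteq> K2 \<and> test_norm N (B f) \<le> C * test_norm M f"
    by (rule continuous_operatorE[OF assms(2) \<open>compact K\<close>], rule that)
  show "\<exists>K'. compact K' \<and> (\<forall>N. \<exists>C M. \<forall>f. supp (fun_of f) \<subseteq> K \<longrightarrow>
      supp (fun_of (test_add (A f) (B f))) \<subseteq> K' \<and>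
      test_norm N (test_add (A f) (B f)) \<le> C * test_norm M f)"
  proof (intro exI[of _ "K1 \<union> K2"] conjI allI)
    show "compact (K1 \<union> K2)" using K1 K2 by auto
    fix N
    obtain C1 M1 where 1: "\<And>f. supp (fun_of f) \<subseteq> K \<Longrightarrow>
        supp (fun_of (A f)) \<subseteq> K1 \<and> test_norm N (A f) \<le> C1 * test_norm M1 f"
      using spec[OF K1(2), of N] by auto
    obtain C2 M2 where 2: "\<And>f. supp (fun_of f) \<subseteq> K \<Longrightarrow>
        supp (fun_of (B f)) \<subseteq> K2 \<and> test_norm N (B f) \<le> C2 * test_norm M2 f"
      using spec[OF K2(2), of N] by auto
    show "\<exists>C M. \<forall>f. supp (fun_of f) \<subseteq> K \<longrightarrow> supp (fun_of (test_add (A f) (B f))) \<subseteq> K1 \<union> K2 \<and>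
      test_norm N (test_add (A f) (B f)) \<le> C * test_norm M f"
    proof (intro exI allI impI conjI)
      fix f
      assume f: "supp (fun_of f) \<subseteq> K"
      show "supp (fun_of (test_add (A f) (B f))) \<subseteq> K1 \<union> K2"
        using supp_add[of "fun_of (A f)" "fun_of (B f)"] 1[OF f] 2[OF f]
        by (auto simp: test_add.rep_eq)
      have le: "C * test_norm M f \<le> \<bar>C\<bar> * test_norm (max M1 M2) f" if "M \<le> max M1 M2" for C M
        by (rule mult_mono) (auto simp: test_norm_nonneg test_norm_mono that)
      have "test_norm N (test_add (A f) (B f)) \<le> test_norm N (A f) + test_norm N (B f)"
        unfolding test_norm_def sum.distrib[symmetric]
      proof (intro sum_mono cSUP_least)
        fix k x
        show "norm (nderiv k (fun_of (test_add (A f) (B f))) x) \<le>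
          (SUP x. norm (nderiv k (fun_of (A f)) x)) + (SUP x. norm (nderiv k (fun_of (B f)) x))"
          using norm_triangle_mono[OF norm_nderiv_le[of k "A f" x] norm_nderiv_le[of k "B f" x]]
          by (simp add: test_add.rep_eq nderiv_add fun_of_test)
      qed simp
      also have "\<dots> \<le> \<bar>C1\<bar> * test_norm (max M1 M2) f + \<bar>C2\<bar> * test_norm (max M1 M2) f"
        using 1[OF f] 2[OF f] le[of M1 C1] le[of M2 C2] by linarith
      finally show "test_norm N (test_add (A f) (B f)) \<le> (\<bar>C1\<bar> + \<bar>C2\<bar>) * test_norm (max M1 M2) f"
        by (simp add: distrib_right)
    qed
  qed
qed

lemma pairing_linear:
  "pairing T (test_add f g) = pairing T f + pairing T g"
  "pairing T (test_scale c f) = c * pairing T f"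
  using pairing[of T] by (auto simp: linear_functional_def)

lemma transpose_exists:
  assumes "continuous_operator B"
  obtains S where "\<And>f. pairing S f = pairing T (B f)"
proof -
  have "linear_functional (\<lambda>f. pairing T (B f))"
    using assms by (simp add: linear_functional_def continuous_operator_def pairing_linear)
  moreover have "continuous_functional (\<lambda>f. pairing T (B f))"
    unfolding continuous_functional_def
  proof (intro allI impI)
    fix K :: "real set" assume "compact K"
    obtain K' where K': "compact K'" "\<forall>N. \<exists>C M. \<forall>f. supp (fun_of f) \<subseteq> K \<longrightarrow>
        supp (fun_of (B f)) \<subseteq> K' \<and> test_norm N (B f) \<le> C * test_norm M f"
      by (rule continuous_operatorE[OF assms \<open>compact K\<close>], rule that)
    have "continuous_functional (pairing T)" using pairing[of T] by simp
    from continuous_functionalE[OF this K'(1)] obtain D N where D: "D \<ge> 0"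
      "\<And>f. supp (fun_of f) \<subseteq> K' \<Longrightarrow> norm (pairing T f) \<le> D * test_norm N f"
      by metis
    obtain C M where C: "\<And>f. supp (fun_of f) \<subseteq> K \<Longrightarrow>
        supp (fun_of (B f)) \<subseteq> K' \<and> test_norm N (B f) \<le> C * test_norm M f"
      using spec[OF K'(2), of N] by auto
    have "norm (pairing T (B f)) \<le> (D * C) * test_norm M f" if "supp (fun_of f) \<subseteq> K" for f
      using D(2)[of "B f"] C[OF that] mult_left_mono[OF _ D(1)] by (force simp: mult.assoc)
    then show "\<exists>C N. \<forall>f. supp (fun_of f) \<subseteq> K \<longrightarrow> norm (pairing T (B f)) \<le> C * test_norm N f"
      by blast
  qed
  ultimately show thesis
    using that[of "Abs_distribution (\<lambda>f. pairing T (B f))"]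
    by (simp add: Abs_distribution_inverse)
qed

text \<open>
  The duality step: if \<open>L\<close> is the transpose of \<open>A\<close> and \<open>B \<circ> A = id\<close>, then
  \<open>S = T \<circ> B\<close> satisfies \<open>L S = T \<circ> B \<circ> A = T\<close>. A left inverse that is defined on all test
  functions spares any description of the range of \<open>A\<close> and any extension of functionals from it.
\<close>

lemma surj_if_transpose_left_inverse:
  assumes L: "\<And>S f. pairing (L S) f = pairing S (A f)"
    and B: "continuous_operator B" "\<And>f. B (A f) = f"
  shows "surj L"
proof (rule surjI)
  fix T
  have "pairing (L (SOME S. \<forall>f. pairing S f = pairing T (B f))) f = pairing T f" for f
  proof -
    have "\<exists>S. \<forall>f. pairing S f = pairing T (B f)"
      using transpose_exists[OF B(1)] by metis
    from someI_ex[OF this] show ?thesis by (simp add: L B(2))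
  qed
  then show "L (SOME S. \<forall>f. pairing S f = pairing T (B f)) = T"
    by (simp flip: pairing_inject add: fun_eq_iff)
qed

section \<open>Integral operators with a cutoff\<close>

lemma continuous_on_param_integrand:
  assumes "smooth f" "continuous_on I w" "continuous_on I \<alpha>" "continuous_on I \<beta>"
  shows "continuous_on I (\<lambda>s. w s * of_real (\<alpha> s) ^ k * nderiv k f (\<alpha> s * x + \<beta> s))"
  by (intro continuous_intros assms continuous_on_compose2[OF smooth_continuous_on[OF assms(1), of UNIV]]) auto

text \<open>
  Differentiating \<open>k\<close> times under the integral multiplies the weight by \<open>\<alpha>\<^sup>k\<close> and replaces \<open>f\<close> by
  its \<open>k\<close>-th derivative, so one formula covers all orders.
\<close>

lemma param_integral_has_derivative:
  fixes w :: "real \<Rightarrow> complex" and \<alpha> \<beta> :: "real \<Rightarrow> real"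
  assumes f: "smooth f"
    and cont: "continuous_on {c..d} w" "continuous_on {c..d} \<alpha>" "continuous_on {c..d} \<beta>"
  defines "F \<equiv> \<lambda>k x. integral {c..d} (\<lambda>s. w s * of_real (\<alpha> s) ^ k * nderiv k f (\<alpha> s * x + \<beta> s))"
  shows "(F k has_vector_derivative F (Suc k) x) (at x)"
proof -
  let ?g = "\<lambda>k x s. w s * of_real (\<alpha> s) ^ k * nderiv k f (\<alpha> s * x + \<beta> s)"
  have "((\<lambda>x. integral (cbox c d) (?g k x)) has_vector_derivative integral (cbox c d) (?g (Suc k) x))
      (at x within UNIV)"
  proof (rule leibniz_rule_vector_derivative)
    fix x s
    have "((\<lambda>x. \<alpha> s * x + \<beta> s) has_vector_derivative \<alpha> s) (at x)"
      by (auto intro!: derivative_eq_intros)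
    from vector_diff_chain_at[OF this smooth_nderiv[OF f, of k]]
    have "((\<lambda>x. nderiv k f (\<alpha> s * x + \<beta> s)) has_vector_derivative
        \<alpha> s *\<^sub>R nderiv (Suc k) f (\<alpha> s * x + \<beta> s)) (at x)"
      by (simp add: o_def)
    from has_vector_derivative_mult_right[OF this, of "w s * of_real (\<alpha> s) ^ k"]
    show "((\<lambda>x. ?g k x s) has_vector_derivative ?g (Suc k) x s) (at x within UNIV)"
      by (simp add: scaleR_conv_of_real algebra_simps)
  next
    show "?g k x integrable_on cbox c d" for x
      unfolding box_real by (rule integrable_continuous_real[OF continuous_on_param_integrand[OF f cont]])
  next
    have *: "continuous_on (UNIV \<times> {c..d}) (\<lambda>z. h (snd z))"
      if "continuous_on {c..d} h" for h :: "real \<Rightarrow> 'a::topological_space"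
      by (rule continuous_on_compose2[OF that]) (auto intro: continuous_intros)
    show "continuous_on (UNIV \<times> cbox c d) (\<lambda>(x, s). ?g (Suc k) x s)"
      unfolding case_prod_beta box_real
      by (intro continuous_intros *[OF cont(1)] *[OF cont(2)] *[OF cont(3)]
          continuous_on_compose2[OF smooth_continuous_on[OF f, of UNIV]]) auto
  qed auto
  then show ?thesis by (simp add: F_def)
qed

lemma
  fixes w :: "real \<Rightarrow> complex" and \<alpha> \<beta> :: "real \<Rightarrow> real"
  assumes "smooth f" "continuous_on {c..d} w" "continuous_on {c..d} \<alpha>" "continuous_on {c..d} \<beta>"
  shows smooth_param_integral: "smooth (\<lambda>x. integral {c..d} (\<lambda>s. w s * f (\<alpha> s * x + \<beta> s)))"
    and nderiv_param_integral: "nderiv k (\<lambda>x. integral {c..d} (\<lambda>s. w s * f (\<alpha> s * x + \<beta> s))) =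
      (\<lambda>x. integral {c..d} (\<lambda>s. w s * of_real (\<alpha> s) ^ k * nderiv k f (\<alpha> s * x + \<beta> s)))"
proof -
  let ?F = "\<lambda>k x. integral {c..d} (\<lambda>s. w s * of_real (\<alpha> s) ^ k * nderiv k f (\<alpha> s * x + \<beta> s))"
  have *: "?F 0 = (\<lambda>x. integral {c..d} (\<lambda>s. w s * f (\<alpha> s * x + \<beta> s)))" by simp
  note ** = param_integral_has_derivative[OF assms]
  show "smooth (\<lambda>x. integral {c..d} (\<lambda>s. w s * f (\<alpha> s * x + \<beta> s)))"
    by (rule smoothI[of ?F, OF * **])
  show "nderiv k (\<lambda>x. integral {c..d} (\<lambda>s. w s * f (\<alpha> s * x + \<beta> s))) = ?F k"
    by (rule nderiv_unique[of ?F, OF * **])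
qed

lemma continuous_on_interval_bound:
  fixes g :: "real \<Rightarrow> complex"
  assumes "continuous_on {c..d} g"
  obtains B where "B \<ge> 0" "\<And>x. x \<in> {c..d} \<Longrightarrow> norm (g x) \<le> B"
proof -
  have "bounded (g ` {c..d})"
    using assms compact_continuous_image compact_imp_bounded by blast
  then obtain B where "\<forall>x\<in>{c..d}. norm (g x) \<le> B"
    by (auto simp: bounded_iff)
  then have "norm (g x) \<le> \<bar>B\<bar>" if "x \<in> {c..d}" for x
    using that by (meson abs_ge_self order_trans)
  then show thesis using that[of "\<bar>B\<bar>"] by simp
qed

text \<open>
  Improper integrals of compactly supported integrands reduce to integrals over compact intervals.
\<close>

lemma integral_eq_on_subset:
  fixes g :: "real \<Rightarrow> complex"
  assumes "S \<subseteq> I" and "\<And>s. s \<in> I \<Longrightarrow> s \<notin> S \<Longrightarrow> g s = 0"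
  shows "integral I g = integral S g"
proof -
  have "integral I g = integral I (\<lambda>s. if s \<in> S then g s else 0)"
    by (rule integral_cong) (use assms(2) in auto)
  then show ?thesis
    using assms(1) by (simp only: Henstock_Kurzweil_Integration.integral_restrict_Int Int_absorb2)
qed

text \<open>
  Both left inverses that are needed below are sums of operators of this form, with
  \<open>\<alpha> s * x + \<beta> s\<close> equal to \<open>x + s\<close> or to \<open>s x\<close>. The last hypothesis is a properness condition: over
  the support of the multiplier, the points \<open>(x, s)\<close> at which the integrand can meet a given bounded
  set stay bounded. It is what allows \<open>I\<close> to be unbounded and \<open>m\<close> to have noncompact support: for
  \<open>f\<close> supported in a fixed compact set, the integral runs effectively over a fixed
  \<open>{c..d}\<close> and the result vanishes off \<open>{-R'..R'}\<close>. The estimates then follow from the Leibniz rule.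
\<close>

lemma cutoff_integral_operator:
  fixes w :: "real \<Rightarrow> complex" and \<alpha> \<beta> :: "real \<Rightarrow> real"
  assumes m: "smooth m"
    and cont: "continuous_on I w" "continuous_on I \<alpha>" "continuous_on I \<beta>"
    and proper: "\<And>R. R \<ge> 0 \<Longrightarrow> \<exists>c d R'. c \<le> d \<and> {c..d} \<subseteq> I \<and>
        (\<forall>x s. m x \<noteq> 0 \<longrightarrow> s \<in> I \<longrightarrow> \<bar>\<alpha> s * x + \<beta> s\<bar> \<le> R \<longrightarrow> s \<in> {c..d} \<and> \<bar>x\<bar> \<le> R')"
  shows "\<exists>B. continuous_operator B \<and>
    (\<forall>f x. fun_of (B f) x = m x * integral I (\<lambda>s. w s * fun_of f (\<alpha> s * x + \<beta> s)))"
proof -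
  define V where "V f x = integral I (\<lambda>s. w s * f (\<alpha> s * x + \<beta> s))" for f :: "real \<Rightarrow> complex" and x
  have local: "\<exists>c d R'. c \<le> d \<and> {c..d} \<subseteq> I \<and> (\<forall>f. supp f \<subseteq> K \<longrightarrow>
      (\<forall>x. m x * V f x = m x * integral {c..d} (\<lambda>s. w s * f (\<alpha> s * x + \<beta> s))) \<and>
      supp (\<lambda>x. m x * V f x) \<subseteq> {-R'..R'})" if "compact K" for K
  proof -
    obtain R where R: "R > 0" "\<forall>y\<in>K. \<bar>y\<bar> \<le> R"
      using compact_imp_bounded[OF \<open>compact K\<close>] by (auto simp: bounded_pos)
    obtain c d R' where cd: "c \<le> d" "{c..d} \<subseteq> I"
      and pr: "\<And>x s. m x \<noteq> 0 \<Longrightarrow> s \<in> I \<Longrightarrow> \<bar>\<alpha> s * x + \<beta> s\<bar> \<le> R \<Longrightarrow> s \<in> {c..d} \<and> \<bar>x\<bar> \<le> R'"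
      using proper[OF less_imp_le[OF R(1)]] by metis
    have "(\<forall>x. m x * V f x = m x * integral {c..d} (\<lambda>s. w s * f (\<alpha> s * x + \<beta> s))) \<and>
      supp (\<lambda>x. m x * V f x) \<subseteq> {-R'..R'}" if f: "supp f \<subseteq> K" for f
    proof
      have zero: "f (\<alpha> s * x + \<beta> s) = 0" if "m x \<noteq> 0" "s \<in> I" "s \<notin> {c..d} \<or> \<bar>x\<bar> > R'" for x s
        using pr[OF that(1,2)] that(3) f R(2) zero_outside_supp[of "\<alpha> s * x + \<beta> s" f] by force
      have "V f x = integral {c..d} (\<lambda>s. w s * f (\<alpha> s * x + \<beta> s))" if "m x \<noteq> 0" for x
        unfolding V_def by (rule integral_eq_on_subset[OF cd(2)]) (use zero[OF that] in auto)
      then show "\<forall>x. m x * V f x = m x * integral {c..d} (\<lambda>s. w s * f (\<alpha> s * x + \<beta> s))" by auto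
      have "m x * V f x = 0" if "x \<notin> {-R'..R'}" for x
      proof (cases "m x = 0")
        case False
        have "\<bar>x\<bar> > R'" using that by auto
        then have "V f x = integral I (\<lambda>_. 0)"
          unfolding V_def by (intro integral_cong) (simp add: zero[OF False])
        then show ?thesis by simp
      qed simp
      then have "{x. m x * V f x \<noteq> 0} \<subseteq> {-R'..R'}" by blast
      then show "supp (\<lambda>x. m x * V f x) \<subseteq> {-R'..R'}"
        unfolding supp_def by (rule closure_minimal) simp
    qed
    with cd show ?thesis by blast
  qed
  have smooth: "smooth (\<lambda>x. m x * V (fun_of f) x) \<and> compact (supp (\<lambda>x. m x * V (fun_of f) x))" for f
  proof -
    obtain c d R' where cd: "c \<le> d" "{c..d} \<subseteq> I"
      and eq: "\<And>x. m x * V (fun_of f) x = m x * integral {c..d} (\<lambda>s. w s * fun_of f (\<alpha> s * x + \<beta> s))"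
      and sub: "supp (\<lambda>x. m x * V (fun_of f) x) \<subseteq> {-R'..R'}"
      using local[OF fun_of_test(2)[of f]] by blast
    have "smooth (\<lambda>x. integral {c..d} (\<lambda>s. w s * fun_of f (\<alpha> s * x + \<beta> s)))"
      by (rule smooth_param_integral[OF fun_of_test(1) cont[THEN continuous_on_subset[OF _ cd(2)]]])
    from smooth_mult[OF m this]
    have "smooth (\<lambda>x. m x * V (fun_of f) x)" by (simp add: eq)
    with compact_supp_subset[OF compact_Icc sub] show ?thesis by blast
  qed
  define B where "B f = Abs_test_fun (\<lambda>x. m x * V (fun_of f) x)" for f
  have B: "fun_of (B f) = (\<lambda>x. m x * V (fun_of f) x)" for f
    unfolding B_def using smooth[of f] by (simp add: Abs_test_fun_inverse)
  have "continuous_operator B"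
    unfolding continuous_operator_def
  proof (intro conjI allI impI)
    fix f g
    let ?K = "supp (fun_of f) \<union> supp (fun_of g)"
    have "compact ?K" by (simp add: compact_Un fun_of_test)
    from local[OF this] obtain c d where cd: "{c..d} \<subseteq> I"
      and eq: "\<And>h x. supp h \<subseteq> ?K \<Longrightarrow> m x * V h x = m x * integral {c..d} (\<lambda>s. w s * h (\<alpha> s * x + \<beta> s))"
      by metis
    have int: "(\<lambda>s. w s * fun_of h (\<alpha> s * x + \<beta> s)) integrable_on {c..d}" for h x
      using continuous_on_param_integrand[OF fun_of_test(1)[of h] cont[THEN continuous_on_subset[OF _ cd]], where k=0 and x=x]
      by (intro integrable_continuous_real) simp
    have "supp (fun_of (test_add f g)) \<subseteq> ?K"
      using supp_add by (simp add: test_add.rep_eq)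
    from eq[OF this]
    show "B (test_add f g) = test_add (B f) (B g)"
      by (simp add: B eq test_add.rep_eq distrib_left integral_add[OF int int] flip: fun_of_inject)
  next
    fix a f
    show "B (test_scale a f) = test_scale a (B f)"
      by (simp add: B V_def test_scale.rep_eq mult.left_commute[of _ a] flip: fun_of_inject)
  next
    fix K :: "real set" assume K: "compact K"
    obtain c d R' where cd: "c \<le> d" "{c..d} \<subseteq> I"
      and loc: "\<forall>f. supp f \<subseteq> K \<longrightarrow>
        (\<forall>x. m x * V f x = m x * integral {c..d} (\<lambda>s. w s * f (\<alpha> s * x + \<beta> s))) \<and>
        supp (\<lambda>x. m x * V f x) \<subseteq> {-R'..R'}"
      using local[OF K] by (elim exE conjE) (rule that)
    have eq: "m x * V f x = m x * integral {c..d} (\<lambda>s. w s * f (\<alpha> s * x + \<beta> s))"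
      and sub: "supp (\<lambda>x. m x * V f x) \<subseteq> {-R'..R'}" if "supp f \<subseteq> K" for f x
      using loc that by simp_all
    note cont' = cont[THEN continuous_on_subset[OF _ cd(2)]]
    define J where "J k f x = integral {c..d} (\<lambda>s. w s * of_real (\<alpha> s) ^ k * nderiv k f (\<alpha> s * x + \<beta> s))"
      for k f x
    have J_bound: "\<exists>W\<ge>0. \<forall>f x. norm (J k (fun_of f) x) \<le> W * test_norm k f" for k
    proof -
      have "continuous_on {c..d} (\<lambda>s. w s * of_real (\<alpha> s) ^ k)"
        by (intro continuous_intros cont')
      then obtain W where W: "W \<ge> 0" "\<And>s. s \<in> {c..d} \<Longrightarrow> norm (w s * of_real (\<alpha> s) ^ k) \<le> W"
        using continuous_on_interval_bound by blast
      have "norm (J k (fun_of f) x) \<le> (W * test_norm k f) * (d - c)" for f x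
        unfolding J_def
      proof (rule integral_bound[OF cd(1) continuous_on_param_integrand[OF fun_of_test(1) cont']])
        fix s assume "s \<in> {c..d}"
        then show "norm (w s * of_real (\<alpha> s) ^ k * nderiv k (fun_of f) (\<alpha> s * x + \<beta> s)) \<le> W * test_norm k f"
          unfolding norm_mult[of "w s * of_real (\<alpha> s) ^ k"]
          by (intro mult_mono W order_trans[OF norm_nderiv_le sup_le_test_norm]) auto
      qed
      then show ?thesis using W(1) cd(1)
        by (intro exI[of _ "W * (d - c)"]) (simp add: mult_ac)
    qed
    have bound: "\<exists>C\<ge>0. \<forall>f x. supp (fun_of f) \<subseteq> K \<longrightarrow> norm (nderiv k (fun_of (B f)) x) \<le> C * test_norm k f" for k
    proof -
      have "\<forall>i. \<exists>M\<ge>0. \<forall>x\<in>{-R'..R'}. norm (nderiv i m x) \<le> M"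
        using continuous_on_interval_bound[OF smooth_continuous_on[OF m]] by metis
      then obtain M where M: "\<And>i. M i \<ge> 0" "\<And>i x. x \<in> {-R'..R'} \<Longrightarrow> norm (nderiv i m x) \<le> M i"
        by metis
      from J_bound obtain W where W: "\<And>i. W i \<ge> 0"
        "\<And>i f x. norm (J i (fun_of f) x) \<le> W i * test_norm i f"
        by metis
      define C where "C = (\<Sum>i=0..k. real (k choose i) * M i * W (k - i))"
      have "norm (nderiv k (fun_of (B f)) x) \<le> C * test_norm k f" if f: "supp (fun_of f) \<subseteq> K" for f x
      proof (cases "x \<in> {-R'..R'}")
        case True
        have J0: "fun_of (B f) = (\<lambda>x. m x * J 0 (fun_of f) x)"
          by (simp add: B eq[OF f] J_def)
        have J_0: "J 0 (fun_of f) = (\<lambda>x. integral {c..d} (\<lambda>s. w s * fun_of f (\<alpha> s * x + \<beta> s)))"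
          by (simp add: J_def fun_eq_iff)
        have J_smooth: "smooth (J 0 (fun_of f))"
          unfolding J_0 by (rule smooth_param_integral[OF fun_of_test(1) cont'])
        have J_nderiv: "nderiv i (J 0 (fun_of f)) = J i (fun_of f)" for i
          unfolding J_0 nderiv_param_integral[OF fun_of_test(1) cont'] by (simp add: J_def fun_eq_iff)
        have "norm (nderiv k (fun_of (B f)) x) =
            norm (\<Sum>i=0..k. of_nat (k choose i) * nderiv i m x * J (k - i) (fun_of f) x)"
          by (simp add: J0 nderiv_mult[OF m J_smooth] J_nderiv)
        also have "\<dots> \<le> (\<Sum>i=0..k. real (k choose i) * M i * (W (k - i) * test_norm k f))"
        proof (intro sum_norm_le)
          fix i assume "i \<in> {0..k}"
          have "norm (J (k - i) (fun_of f) x) \<le> W (k - i) * test_norm k f"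
            by (rule order_trans[OF W(2)]) (intro mult_left_mono test_norm_mono W(1), simp)
          then show "norm (of_nat (k choose i) * nderiv i m x * J (k - i) (fun_of f) x)
              \<le> real (k choose i) * M i * (W (k - i) * test_norm k f)"
            unfolding norm_mult by (intro mult_mono M True) (auto simp: M(1))
        qed
        also have "\<dots> = C * test_norm k f"
          by (simp add: C_def sum_distrib_right mult.assoc)
        finally show ?thesis .
      next
        case False
        then have "x \<notin> supp (fun_of (B f))" using sub[OF f] by (auto simp: B)
        then show ?thesis
          by (simp add: nderiv_outside_supp C_def test_norm_nonneg sum_nonneg M(1) W(1))
      qed
      moreover have "C \<ge> 0" by (simp add: C_def sum_nonneg M(1) W(1))
      ultimately show ?thesis by blast
    qed
    then obtain C where C: "\<And>k. C k \<ge> 0"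
      "\<And>k f x. supp (fun_of f) \<subseteq> K \<Longrightarrow> norm (nderiv k (fun_of (B f)) x) \<le> C k * test_norm k f"
      by metis
    show "\<exists>K'. compact K' \<and> (\<forall>N. \<exists>C M. \<forall>f. supp (fun_of f) \<subseteq> K \<longrightarrow>
        supp (fun_of (B f)) \<subseteq> K' \<and> test_norm N (B f) \<le> C * test_norm M f)"
    proof (intro exI conjI allI impI)
      fix N f assume f: "supp (fun_of f) \<subseteq> K"
      show "supp (fun_of (B f)) \<subseteq> {-R'..R'}" using sub[OF f] by (simp add: B)
      have "test_norm N (B f) \<le> (\<Sum>k\<le>N. C k * test_norm N f)"
        unfolding test_norm_def[of N "B f"]
      proof (intro sum_mono cSUP_least)
        fix k x assume "k \<in> {..N}"
        then show "norm (nderiv k (fun_of (B f)) x) \<le> C k * test_norm N f"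
          by (intro order_trans[OF C(2)[OF f]] mult_left_mono test_norm_mono C(1)) simp
      qed simp
      then show "test_norm N (B f) \<le> (\<Sum>k\<le>N. C k) * test_norm N f"
        by (simp add: sum_distrib_right)
    qed simp
  qed
  then show ?thesis
    by (intro exI[of _ B]) (simp add: B V_def)
qed

lemma test_fun_vanishes:
  obtains R where "R > 0" "\<And>k y. \<bar>y\<bar> > R \<Longrightarrow> nderiv k (fun_of f) y = 0"
proof -
  obtain R where "R > 0" "\<forall>y\<in>supp (fun_of f). \<bar>y\<bar> \<le> R"
    using compact_imp_bounded[OF fun_of_test(2)[of f]] by (auto simp: bounded_pos)
  then show thesis
    using that[of R] nderiv_outside_supp[of _ "fun_of f"] by (meson not_le)
qed

section \<open>Surjectivity of the derivative\<close>

text \<open>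
  The transpose of \<open>d/dx\<close> is \<open>A = - d/dx\<close>. An antiderivative of \<open>f\<close> taken from the left has the
  wrong support on the right, and one taken from the right has the wrong support on the left. On the
  range of \<open>A\<close> the two agree, so gluing them with a smooth step \<open>h\<close> gives a left inverse:
  \<open>(h(x) - 1) \<integral>_{s \<le> 0} f(x + s) ds + h(x) \<integral>_{s \<ge> 0} f(x + s) ds\<close>.
\<close>

lemma surj_dist_deriv: "surj dist_deriv"
proof -
  obtain h where h: "smooth h" "\<And>x. x \<le> 0 \<Longrightarrow> h x = 0" "\<And>x. x \<ge> 1 \<Longrightarrow> h x = 1"
    using smooth_step_exists by blast
  have "\<exists>B. continuous_operator B \<and>
    (\<forall>f x. fun_of (B f) x = (h x - 1) * integral {..0} (\<lambda>s. 1 * fun_of f (1 * x + s)))"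
  proof (rule cutoff_integral_operator)
    show "smooth (\<lambda>x. h x - 1)" by (intro smooth_diff h smooth_const)
    fix R :: real assume "R \<ge> 0"
    have *: "\<forall>x s. h x - 1 \<noteq> 0 \<longrightarrow> s \<in> {..0} \<longrightarrow> \<bar>1 * x + s\<bar> \<le> R \<longrightarrow> s \<in> {-R-1..0} \<and> \<bar>x\<bar> \<le> R + 1"
    proof (intro allI impI)
      fix x s assume xs: "h x - 1 \<noteq> 0" "s \<in> {..0}" "\<bar>1 * x + s\<bar> \<le> R"
      have "x < 1" using xs(1) h(3)[of x] by force
      then show "s \<in> {-R-1..0} \<and> \<bar>x\<bar> \<le> R + 1" using xs(2,3) by auto
    qed
    show "\<exists>c d R'. c \<le> d \<and> {c..d} \<subseteq> {..0} \<and> (\<forall>x s. h x - 1 \<noteq> 0 \<longrightarrow> s \<in> {..0} \<longrightarrow>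
        \<bar>1 * x + s\<bar> \<le> R \<longrightarrow> s \<in> {c..d} \<and> \<bar>x\<bar> \<le> R')"
      using \<open>R \<ge> 0\<close> by - (rule exI[of _ "-R-1"], rule exI[of _ 0], rule exI[of _ "R+1"], intro conjI *, auto)
  qed (auto intro: continuous_intros)
  then obtain B1 where B1: "continuous_operator B1"
    "\<And>f x. fun_of (B1 f) x = (h x - 1) * integral {..0} (\<lambda>s. 1 * fun_of f (1 * x + s))"
    by (elim exE conjE) (rule that, assumption, simp)
  have "\<exists>B. continuous_operator B \<and>
    (\<forall>f x. fun_of (B f) x = h x * integral {0..} (\<lambda>s. 1 * fun_of f (1 * x + s)))"
  proof (rule cutoff_integral_operator)
    show "smooth h" by (rule h)
    fix R :: real assume "R \<ge> 0"
    have *: "\<forall>x s. h x \<noteq> 0 \<longrightarrow> s \<in> {0..} \<longrightarrow> \<bar>1 * x + s\<bar> \<le> R \<longrightarrow> s \<in> {0..R} \<and> \<bar>x\<bar> \<le> R"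
    proof (intro allI impI)
      fix x s assume xs: "h x \<noteq> 0" "s \<in> {0..}" "\<bar>1 * x + s\<bar> \<le> R"
      have "x > 0" using xs(1) h(2)[of x] by force
      then show "s \<in> {0..R} \<and> \<bar>x\<bar> \<le> R" using xs(2,3) by auto
    qed
    show "\<exists>c d R'. c \<le> d \<and> {c..d} \<subseteq> {0..} \<and> (\<forall>x s. h x \<noteq> 0 \<longrightarrow> s \<in> {0..} \<longrightarrow>
        \<bar>1 * x + s\<bar> \<le> R \<longrightarrow> s \<in> {c..d} \<and> \<bar>x\<bar> \<le> R')"
      using \<open>R \<ge> 0\<close> by - (rule exI[of _ 0], rule exI[of _ R], rule exI[of _ R], intro conjI *, auto)
  qed (auto intro: continuous_intros)
  then obtain B2 where B2: "continuous_operator B2"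
    "\<And>f x. fun_of (B2 f) x = h x * integral {0..} (\<lambda>s. 1 * fun_of f (1 * x + s))"
    by (elim exE conjE) (rule that, assumption, simp)
  show ?thesis
  proof (rule surj_if_transpose_left_inverse)
    show "pairing (dist_deriv S) f = pairing S (test_scale (-1) (test_deriv f))" for S f
      by (simp add: dist_deriv.rep_eq pairing_linear)
    show "continuous_operator (\<lambda>f. test_add (B1 f) (B2 f))"
      by (rule continuous_operator_add[OF B1(1) B2(1)])
    fix f
    let ?A = "test_scale (-1) (test_deriv f)"
    obtain R where R: "R > 0" "\<And>k y. \<bar>y\<bar> > R \<Longrightarrow> nderiv k (fun_of f) y = 0"
      by (rule test_fun_vanishes[where f=f]) (rule that)
    have zero: "fun_of f y = 0" "fun_of ?A y = 0" if "\<bar>y\<bar> > R" for y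
      using R(2)[OF that, of 0] R(2)[OF that, of 1] by (simp_all add: test_scale.rep_eq test_deriv.rep_eq)
    have ftc: "integral {c..d} (\<lambda>s. fun_of ?A (x + s)) = fun_of f (x + c) - fun_of f (x + d)"
      if "c \<le> d" for c d x
    proof -
      have "((\<lambda>s. fun_of ?A (x + s)) has_integral (- fun_of f (x + d) - - fun_of f (x + c))) {c..d}"
      proof (rule fundamental_theorem_of_calculus[OF that])
        fix s
        have "((\<lambda>s. x + s) has_vector_derivative 1) (at s)"
          by (auto intro!: derivative_eq_intros)
        from vector_diff_chain_at[OF this smooth_nderiv[OF fun_of_test(1), of 0 f]]
        have "((\<lambda>s. - fun_of f (x + s)) has_vector_derivative - nderiv 1 (fun_of f) (x + s)) (at s)"
          by (intro has_vector_derivative_minus) (simp add: o_def)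
        then show "((\<lambda>s. - fun_of f (x + s)) has_vector_derivative fun_of ?A (x + s)) (at s within {c..d})"
          by (simp add: test_scale.rep_eq test_deriv.rep_eq has_vector_derivative_at_within)
      qed
      then show ?thesis by (simp add: integral_unique)
    qed
    have "fun_of (test_add (B1 ?A) (B2 ?A)) x = fun_of f x" for x
    proof -
      define L where "L = \<bar>x\<bar> + R + 1"
      have "integral {..0} (\<lambda>s. fun_of ?A (x + s)) = integral {-L..0} (\<lambda>s. fun_of ?A (x + s))"
        by (rule integral_eq_on_subset) (auto intro!: zero simp: L_def)
      also have "\<dots> = - fun_of f x"
        using R(1) by (subst ftc) (auto simp: L_def zero)
      finally have 1: "integral {..0} (\<lambda>s. fun_of ?A (x + s)) = - fun_of f x" .
      have "integral {0..} (\<lambda>s. fun_of ?A (x + s)) = integral {0..L} (\<lambda>s. fun_of ?A (x + s))"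
        by (rule integral_eq_on_subset) (auto intro!: zero simp: L_def)
      also have "\<dots> = fun_of f x"
        using R(1) by (subst ftc) (auto simp: L_def zero)
      finally have 2: "integral {0..} (\<lambda>s. fun_of ?A (x + s)) = fun_of f x" .
      show ?thesis by (simp add: test_add.rep_eq B1(2) B2(2) 1 2) (simp add: algebra_simps)
    qed
    then show "test_add (B1 ?A) (B2 ?A) = f"
      by (simp add: fun_eq_iff flip: fun_of_inject)
  qed
qed

section \<open>Surjectivity of first-order Euler operators\<close>

text \<open>
  The transpose of \<open>\<theta> - a\<close> is \<open>A f = - (x f' + (1 + a) f)\<close>, and
  \<open>d/ds (s^(a+1) f(s x)) = - s^a (A f)(s x)\<close>. Hence \<open>\<integral>_1^\<infinity> s^a g(s x) ds\<close> and
  \<open>- \<integral>_0^1 s^a g(s x) ds\<close> both recover \<open>f\<close> from \<open>g = A f\<close>. For a general test function \<open>g\<close> the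
  first has compact support but may be singular at the origin, while the second is smooth at the
  origin but may fail to decay. The left inverse uses each where it is good, gluing with a
  function \<open>e\<close> that vanishes near the origin and is one near infinity. The hypothesis on \<open>a\<close> makes
  the weight \<open>s^a\<close> continuous on \<open>{0..1}\<close>, with value 0 at \<open>s = 0\<close>.
\<close>

lemma surj_theta_minus_Re_pos:
  assumes "Re a > 0"
  shows "surj (\<lambda>S. theta S + dist_scale (- a) S)"
proof -
  obtain h where h: "smooth h" "\<And>x. x \<le> 0 \<Longrightarrow> h x = 0" "\<And>x. x \<ge> 1 \<Longrightarrow> h x = 1"
    using smooth_step_exists by blast
  define e where "e x = h (1 * x + (-1)) + h ((-1) * x + (-1))" for x
  have e_smooth: "smooth e"
    unfolding e_def by (intro smooth_add smooth_affine h(1))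
  have e_0: "e x = 0" if "\<bar>x\<bar> \<le> 1" for x
    using that by (simp add: e_def h(2))
  have e_1: "e x = 1" if "\<bar>x\<bar> \<ge> 2" for x
    using that h(2,3) by (cases "x \<ge> 0") (simp_all add: e_def)
  define w where "w s = (of_real s :: complex) powr a" for s :: real
  have w_cont: "continuous_on {c..} w" if "c \<ge> 0" for c
    unfolding w_def using assms that by (intro continuous_intros) (auto simp: complex_nonpos_Reals_iff)
  have "\<exists>B. continuous_operator B \<and>
    (\<forall>f x. fun_of (B f) x = e x * integral {1..} (\<lambda>s. w s * fun_of f (s * x + 0)))"
  proof (rule cutoff_integral_operator)
    show "smooth e" by (rule e_smooth)
    show "continuous_on {1..} w" by (rule w_cont) simp
    fix R :: real assume "R \<ge> 0"
    have *: "\<forall>x s. e x \<noteq> 0 \<longrightarrow> s \<in> {1..} \<longrightarrow> \<bar>s * x + 0\<bar> \<le> R \<longrightarrow> s \<in> {1..R+1} \<and> \<bar>x\<bar> \<le> R"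
    proof (intro allI impI)
      fix x s assume xs: "e x \<noteq> 0" "s \<in> {1..}" "\<bar>s * x + 0\<bar> \<le> R"
      have x: "\<bar>x\<bar> \<ge> 1" using xs(1) e_0[of x] by force
      have "s * 1 \<le> s * \<bar>x\<bar>" "1 * \<bar>x\<bar> \<le> s * \<bar>x\<bar>"
        using x xs(2) by (intro mult_left_mono mult_right_mono; simp)+
      moreover have "s * \<bar>x\<bar> \<le> R" using xs(2,3) by (simp add: abs_mult)
      ultimately have "s \<le> R" "\<bar>x\<bar> \<le> R" by linarith+
      then show "s \<in> {1..R+1} \<and> \<bar>x\<bar> \<le> R" using xs(2) by simp
    qed
    show "\<exists>c d R'. c \<le> d \<and> {c..d} \<subseteq> {1..} \<and> (\<forall>x s. e x \<noteq> 0 \<longrightarrow> s \<in> {1..} \<longrightarrow>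
        \<bar>s * x + 0\<bar> \<le> R \<longrightarrow> s \<in> {c..d} \<and> \<bar>x\<bar> \<le> R')"
      using \<open>R \<ge> 0\<close> by - (rule exI[of _ 1], rule exI[of _ "R + 1"], rule exI[of _ R], intro conjI *, auto)
  qed (auto intro: continuous_intros)
  then obtain B1 where B1: "continuous_operator B1"
    "\<And>f x. fun_of (B1 f) x = e x * integral {1..} (\<lambda>s. w s * fun_of f (s * x + 0))"
    by (elim exE conjE) (rule that, assumption, simp)
  have "\<exists>B. continuous_operator B \<and>
    (\<forall>f x. fun_of (B f) x = (e x - 1) * integral {0..1} (\<lambda>s. w s * fun_of f (s * x + 0)))"
  proof (rule cutoff_integral_operator)
    show "smooth (\<lambda>x. e x - 1)" by (intro smooth_diff e_smooth smooth_const)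
    show "continuous_on {0..1} w" by (rule continuous_on_subset[OF w_cont[of 0]]) auto
    fix R :: real assume "R \<ge> 0"
    have "\<bar>x\<bar> \<le> 2" if "e x - 1 \<noteq> 0" for x
      using that e_1[of x] by force
    then show "\<exists>c d R'. c \<le> d \<and> {c..d} \<subseteq> {0..1} \<and> (\<forall>x s. e x - 1 \<noteq> 0 \<longrightarrow> s \<in> {0..1} \<longrightarrow>
        \<bar>s * x + 0\<bar> \<le> R \<longrightarrow> s \<in> {c..d} \<and> \<bar>x\<bar> \<le> R')"
      by - (rule exI[of _ 0], rule exI[of _ 1], rule exI[of _ 2], simp)
  qed (auto intro: continuous_intros)
  then obtain B2 where B2: "continuous_operator B2"
    "\<And>f x. fun_of (B2 f) x = (e x - 1) * integral {0..1} (\<lambda>s. w s * fun_of f (s * x + 0))"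
    by (elim exE conjE) (rule that, assumption, simp)
  (* This is the transpose of theta - a, written with the operations on test functions. *)
  define A where "A f = test_add (test_scale (-1) (test_deriv (test_xmult f))) (test_scale (- a) f)" for f
  show ?thesis
  proof (rule surj_if_transpose_left_inverse)
    show "pairing (theta S + dist_scale (- a) S) f = pairing S (A f)" for S f
      by (simp add: A_def theta_def dist_deriv.rep_eq dist_xmult.rep_eq plus_distribution.rep_eq dist_scale.rep_eq pairing_linear)
    show "continuous_operator (\<lambda>f. test_add (B1 f) (B2 f))"
      by (rule continuous_operator_add[OF B1(1) B2(1)])
    fix f
    have A: "fun_of (A f) y = - (of_real y * nderiv 1 (fun_of f) y + (1 + a) * fun_of f y)" for y
      using nderiv_xmult[OF fun_of_test(1), of 1 f]
      by (simp add: A_def test_add.rep_eq test_scale.rep_eq test_deriv.rep_eq test_xmult.rep_eq algebra_simps del: One_nat_def)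
    obtain R where R: "R > 0" "\<And>k y. \<bar>y\<bar> > R \<Longrightarrow> nderiv k (fun_of f) y = 0"
      by (rule test_fun_vanishes[where f=f]) (rule that)
    have zero: "fun_of f y = 0" "fun_of (A f) y = 0" if "\<bar>y\<bar> > R" for y
      using R(2)[OF that, of 0] R(2)[OF that, of 1] by (simp_all add: A)
    have ftc: "integral {c..d} (\<lambda>s. w s * fun_of (A f) (s * x)) =
        of_real c * w c * fun_of f (c * x) - of_real d * w d * fun_of f (d * x)"
      if cd: "0 \<le> c" "c \<le> d" for c d x
    proof -
      let ?F = "\<lambda>s. - (of_real s * w s * fun_of f (s * x))"
      have "((\<lambda>s. w s * fun_of (A f) (s * x)) has_integral (?F d - ?F c)) {c..d}"
      proof (rule fundamental_theorem_of_calculus_interior[OF cd(2)])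
        have "continuous_on {c..d} w" by (rule continuous_on_subset[OF w_cont[OF cd(1)]]) auto
        then show "continuous_on {c..d} ?F"
          by (intro continuous_intros continuous_on_compose2[OF smooth_continuous_on[OF fun_of_test(1), of UNIV 0 f, simplified]]) auto
        (* The weight is not differentiable at 0, whence the interior version of the fundamental theorem. *)
        fix s assume "s \<in> {c<..<d}"
        then have s: "s > 0" using cd by auto
        have "((\<lambda>z. z * z powr a) has_field_derivative (1 + a) * w s) (at (of_real s))"
          using s by (auto intro!: derivative_eq_intros has_field_derivative_powr
              simp: w_def complex_nonpos_Reals_iff powr_diff algebra_simps)
        from has_vector_derivative_real_field[OF this]
        have 1: "((\<lambda>s. of_real s * w s) has_vector_derivative (1 + a) * w s) (at s)"
          by (simp add: w_def)
        have "((\<lambda>s. s * x) has_vector_derivative x) (at s)"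
          by (auto intro!: derivative_eq_intros)
        from vector_diff_chain_at[OF this smooth_nderiv[OF fun_of_test(1), of 0 f]]
        have 2: "((\<lambda>s. fun_of f (s * x)) has_vector_derivative of_real x * nderiv 1 (fun_of f) (s * x)) (at s)"
          by (simp add: o_def scaleR_conv_of_real)
        from has_vector_derivative_minus[OF has_vector_derivative_mult[OF 1 2]]
        show "(?F has_vector_derivative w s * fun_of (A f) (s * x)) (at s)"
          by (simp add: A algebra_simps)
      qed
      then show ?thesis by (simp add: integral_unique)
    qed
    have "fun_of (test_add (B1 (A f)) (B2 (A f))) x = fun_of f x" for x
    proof -
      have w1: "w 1 = 1" by (simp add: w_def)
      have 1: "integral {1..} (\<lambda>s. w s * fun_of (A f) (s * x)) = fun_of f x" if "e x \<noteq> 0"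
      proof -
        have x: "\<bar>x\<bar> \<ge> 1" using that e_0[of x] by force
        have big: "\<bar>s * x\<bar> > R" if "s > R" for s
        proof -
          have "s * 1 \<le> s * \<bar>x\<bar>" using that R(1) x by (intro mult_left_mono) auto
          then have "R < s * \<bar>x\<bar>" using that by linarith
          then show ?thesis using that R(1) by (simp add: abs_mult)
        qed
        have "integral {1..} (\<lambda>s. w s * fun_of (A f) (s * x)) = integral {1..R+1} (\<lambda>s. w s * fun_of (A f) (s * x))"
          by (rule integral_eq_on_subset) (auto intro!: zero big)
        also have "\<dots> = fun_of f x"
          using R(1) by (subst ftc) (auto simp: zero big w1)
        finally show ?thesis .
      qed
      have 2: "integral {0..1} (\<lambda>s. w s * fun_of (A f) (s * x)) = - fun_of f x"
        by (subst ftc) (simp_all add: w1)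
      show ?thesis using 1 by (cases "e x = 0") (simp_all add: test_add.rep_eq B1(2) B2(2) 2 left_diff_distrib)
    qed
    then show "test_add (B1 (A f)) (B2 (A f)) = f"
      by (simp add: fun_eq_iff flip: fun_of_inject)
  qed
qed

section \<open>Arbitrary roots and polynomials\<close>

lemma dist_eqI: "(\<And>f. pairing S f = pairing T f) \<Longrightarrow> S = T"
  by (simp add: fun_eq_iff flip: pairing_inject)

lemmas pairing_simps = plus_distribution.rep_eq zero_distribution.rep_eq dist_scale.rep_eq
  dist_deriv.rep_eq dist_xmult.rep_eq

lemma pairing_sum: "pairing (\<Sum>i\<in>A. S i) f = (\<Sum>i\<in>A. pairing (S i) f)"
  by (induction A rule: infinite_finite_induct) (simp_all add: pairing_simps)

lemma theta_add: "theta (S + T) = theta S + theta T"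
  by (rule dist_eqI) (simp add: theta_def pairing_simps)

lemma theta_scale: "theta (dist_scale c S) = dist_scale c (theta S)"
  by (rule dist_eqI) (simp add: theta_def pairing_simps)

lemma theta_sum: "theta (\<Sum>i\<in>A. S i) = (\<Sum>i\<in>A. theta (S i))"
proof -
  have "theta 0 = 0" by (rule dist_eqI) (simp add: theta_def pairing_simps)
  then show ?thesis by (induction A rule: infinite_finite_induct) (simp_all add: theta_add)
qed

lemma test_deriv_xmult: "test_deriv (test_xmult f) = test_add (test_xmult (test_deriv f)) f"
  by (simp add: test_deriv.rep_eq test_xmult.rep_eq test_add.rep_eq
      nderiv_xmult[OF fun_of_test(1), of 1, simplified] flip: fun_of_inject)

lemma dist_deriv_theta: "dist_deriv (theta S) = theta (dist_deriv S) + dist_deriv S"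
  by (rule dist_eqI) (simp add: theta_def pairing_simps test_deriv_xmult test_deriv_add pairing_linear)

text \<open>
  The relation \<open>D (\<theta> - (a + 1)) = (\<theta> - a) D\<close> for \<open>D = d/dx\<close> transfers surjectivity from
  \<open>a + 1\<close> to \<open>a\<close>, because \<open>D\<close> is surjective. Shifting \<open>a\<close> often enough to the right reaches the
  half plane already treated; this also covers the negative integers, where the
  solution formulas themselves would produce logarithms.
\<close>

lemma surj_theta_minus: "surj (\<lambda>S. theta S + dist_scale (- a) S)"
proof -
  have "surj (\<lambda>S. theta S + dist_scale (- a) S)" if "Re a + real n > 0" for n
    using that
  proof (induction n arbitrary: a)
    case 0
    then show ?case by (intro surj_theta_minus_Re_pos) simp
  next
    case (Suc n)
    have IH: "surj (\<lambda>S. theta S + dist_scale (- (a + 1)) S)"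
      using Suc.prems by (intro Suc.IH) simp
    show ?case
      unfolding surj_def
    proof
      fix T
      obtain U where U: "T = dist_deriv U" using surj_dist_deriv by (metis surjD)
      obtain V where V: "U = theta V + dist_scale (- (a + 1)) V" using IH by (metis (no_types, lifting) surjD)
      have "T = theta (dist_deriv V) + dist_scale (- a) (dist_deriv V)"
      proof (rule dist_eqI)
        fix f
        have "pairing T f = pairing (dist_deriv (theta V)) f + pairing (dist_scale (- (a + 1)) (dist_deriv V)) f"
          by (simp add: U V pairing_simps)
        then show "pairing T f = pairing (theta (dist_deriv V) + dist_scale (- a) (dist_deriv V)) f"
          by (simp add: dist_deriv_theta) (simp add: pairing_simps algebra_simps)
      qed
      then show "\<exists>S. T = theta S + dist_scale (- a) S" by blast
    qed
  qed
  moreover obtain n where "real n > - Re a" using reals_Archimedean2 by blast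
  then have "Re a + real n > 0" by linarith
  ultimately show ?thesis by blast
qed

lemma euler_op_altdef:
  assumes "degree P \<le> n"
  shows "euler_op P T = (\<Sum>k\<le>n. dist_scale (coeff P k) ((theta ^^ k) T))"
proof -
  have zero: "dist_scale 0 S = 0" for S
    by (rule dist_eqI) (simp add: pairing_simps)
  show ?thesis
    unfolding euler_op_def
    by (rule sum.mono_neutral_left) (use assms in \<open>auto simp: zero coeff_eq_0\<close>)
qed

lemma euler_op_pCons: "euler_op (pCons c Q) T = dist_scale c T + theta (euler_op Q T)"
  by (simp add: euler_op_altdef[OF degree_pCons_le] euler_op_altdef[of Q "degree Q", OF order_refl]
      sum.atMost_Suc_shift theta_sum theta_scale del: sum.atMost_Suc)

text \<open>
  The instance of \<open>(P Q)(\<theta>) = P(\<theta>) Q(\<theta>)\<close> that peels off one root.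
\<close>

lemma euler_op_linear_factor:
  "euler_op ([:- a, 1:] * Q) T = theta (euler_op Q T) + dist_scale (- a) (euler_op Q T)"
proof -
  have deg: "degree ([:- a, 1:] * Q) \<le> Suc (degree Q)"
    using degree_mult_le[of "[:- a, 1:]" Q] by simp
  have "euler_op ([:- a, 1:] * Q) T = (\<Sum>k\<le>Suc (degree Q). dist_scale (coeff (pCons 0 Q) k) ((theta ^^ k) T))
      + dist_scale (- a) (\<Sum>k\<le>Suc (degree Q). dist_scale (coeff Q k) ((theta ^^ k) T))"
    unfolding euler_op_altdef[OF deg]
    by (rule dist_eqI) (simp add: pairing_sum pairing_simps sum_distrib_left sum.distrib[symmetric] algebra_simps del: sum.atMost_Suc)
  also have "(\<Sum>k\<le>Suc (degree Q). dist_scale (coeff (pCons 0 Q) k) ((theta ^^ k) T)) = theta (euler_op Q T)"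
    using euler_op_pCons[of 0 Q T]
    by (simp add: euler_op_altdef[OF degree_pCons_le, of 0 Q] pairing_simps dist_eqI)
  also have "(\<Sum>k\<le>Suc (degree Q). dist_scale (coeff Q k) ((theta ^^ k) T)) = euler_op Q T"
    by (rule euler_op_altdef[symmetric]) simp
  finally show ?thesis .
qed

theorem theorem4:
  fixes P :: "complex poly"
  assumes "P \<noteq> 0"
  shows "surj (euler_op P)"
  using assms
proof (induction "degree P" arbitrary: P)
  case 0
  then obtain c where P: "P = [:c:]" "c \<noteq> 0" by (metis degree_0_id degree_eq_zeroE pCons_0_0)
  have "euler_op P (dist_scale (inverse c) T) = T" for T
    using P by (intro dist_eqI) (simp add: euler_op_def pairing_simps)
  then show ?case by (rule surjI)
next
  case (Suc n)
  have "\<not> constant (poly P)" using Suc.hyps(2) by (simp add: constant_degree)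
  then obtain a where "poly P a = 0" using fundamental_theorem_of_algebra by blast
  then obtain Q where P: "P = [:- a, 1:] * Q" by (metis dvdE poly_eq_0_iff_dvd)
  have "Q \<noteq> 0" using P Suc.prems by auto
  then have "degree Q = n" using Suc.hyps(2) P degree_mult_eq[of "[:- a, 1:]" Q] by simp
  then have "surj (euler_op Q)" using Suc.hyps(1)[of Q] \<open>Q \<noteq> 0\<close> by simp
  then have "surj ((\<lambda>S. theta S + dist_scale (- a) S) \<circ> euler_op Q)"
    by (rule comp_surj[OF _ surj_theta_minus])
  also have "(\<lambda>S. theta S + dist_scale (- a) S) \<circ> euler_op Q = euler_op P"
    by (rule ext) (simp only: P euler_op_linear_factor o_def)
  finally show ?case .
qed

end
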